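(* Let $\mathcal H = (A, M)$ be a hypergraph, where $A$ is a finite nonempty set, $M$ is a family of subsets of $A$ with $\emptyset \in M$, and every $a \in A$ is contained in some $m \in M$. Then $p_U = \frac{1}{k^{=}_f(\mathcal H)}$ if $k^{=}_f(\mathcal H)$ is finite, and $p_U = 0$ otherwise.
   Context: For $a \in A$, write $M_a = \{m \in M : a \in m\}$. The uniform fairness $p_U$ of $(A,M)$ is the optimal value of the linear program: maximize $p$ subject to $\sum_{m \in M_a} x_m = p$ for all $a \in A$, $\sum_{m \in M} x_m = 1$, $x_m \ge 0$ for all $m \in M$, $p \in \mathbb{R}$. The fractional partitioning number $k^{=}_f(\mathcal H)$ of the hypergraph $\mathcal H = (A,M)$ (vertex set $A$, hyperedges $M$) is the optimal value of the linear program: minimize $\sum_{m \in M} w_m$ subject to $\sum_{m \in M_a} w_m = 1$ for all $a \in A$ and $w_m \ge 0$ for all $m \in M$; by convention $k^{=}_f(\mathcal H) = \infty$ if this program is infeasible. *)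

theory Defs
  imports Complex_Main "HOL-Library.Extended_Real"
begin

definition incident :: "'a set set \<Rightarrow> 'a \<Rightarrow> 'a set set" where
  "incident M a = {m \<in> M. a \<in> m}"

definition uniform_feasible :: "'a set \<Rightarrow> 'a set set \<Rightarrow> ('a set \<Rightarrow> real) \<Rightarrow> real \<Rightarrow> bool" where
  "uniform_feasible A M x p \<longleftrightarrow>
     (\<forall>a\<in>A. (\<Sum>m\<in>incident M a. x m) = p) \<and> (\<Sum>m\<in>M. x m) = 1 \<and> (\<forall>m\<in>M. 0 \<le> x m)"

text \<open>
  The optimal value of a linear program is the supremum (infimum) of the objective over the
  feasible solutions, taken in the extended reals: an infeasible minimization program has
  value \<open>\<infinity>\<close>, an infeasible maximization program has value \<open>-\<infinity>\<close>.
  The variables indexed by \<open>M\<close> are modelled by total functions whose values outside \<open>M\<close>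
  occur in no constraint or objective.
\<close>

definition uniform_fairness :: "'a set \<Rightarrow> 'a set set \<Rightarrow> ereal" where
  "uniform_fairness A M = Sup {ereal p |x p. uniform_feasible A M x p}"

definition fractional_partition :: "'a set \<Rightarrow> 'a set set \<Rightarrow> ('a set \<Rightarrow> real) \<Rightarrow> bool" where
  "fractional_partition A M w \<longleftrightarrow>
     (\<forall>a\<in>A. (\<Sum>m\<in>incident M a. w m) = 1) \<and> (\<forall>m\<in>M. 0 \<le> w m)"

definition fractional_partitioning_number :: "'a set \<Rightarrow> 'a set set \<Rightarrow> ereal" where
  "fractional_partitioning_number A M =
     Inf {ereal (\<Sum>m\<in>M. w m) |w. fractional_partition A M w}"

end

theory Submission
  imports Defs
begin

text \<open>
  The two programs are related by rescaling. A uniform solution of value \<open>p > 0\<close> has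
  total weight \<open>1\<close> and covers every vertex with weight \<open>p\<close>; dividing by \<open>p\<close> gives a
  fractional partition of total weight \<open>1 / p\<close>. A fractional partition of total weight \<open>W\<close>,
  divided by \<open>W\<close>, gives back a uniform solution of value \<open>1 / W\<close>; here \<open>W \<ge> 1\<close>, because already
  the edges at a single vertex carry weight \<open>1\<close>. Besides these, \<open>0\<close> is a value: put all
  weight on the empty edge. The values of the uniform program are therefore \<open>0\<close> and the
  reciprocals of the totals of fractional partitions (lemma \<open>uniform_values_eq\<close>).

  As \<open>t \<mapsto> 1 / t\<close> reverses the order on the positive reals, the supremum of these values is
  the reciprocal of the infimum of the totals, and it is \<open>0\<close> when there are no totals
  (lemma \<open>Sup_reciprocals\<close>).
\<close>

lemma partition_of_uniform:
  assumes "uniform_feasible A M x p" and "0 < p"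
  shows "fractional_partition A M (\<lambda>m. x m / p)" and "(\<Sum>m\<in>M. x m / p) = 1 / p"
  using assms
  by (auto simp: uniform_feasible_def fractional_partition_def simp flip: sum_divide_distrib)

lemma uniform_of_partition:
  assumes "fractional_partition A M w" and "0 < (\<Sum>m\<in>M. w m)"
  shows "uniform_feasible A M (\<lambda>m. w m / (\<Sum>m\<in>M. w m)) (1 / (\<Sum>m\<in>M. w m))"
  using assms
  by (auto simp: uniform_feasible_def fractional_partition_def simp flip: sum_divide_distrib)

lemma partition_total_ge_1:
  assumes "fractional_partition A M w" and "finite M" and "A \<noteq> {}"
  shows "1 \<le> (\<Sum>m\<in>M. w m)"
proof -
  obtain a where "a \<in> A"
    using \<open>A \<noteq> {}\<close> by blast
  then have "1 = (\<Sum>m\<in>incident M a. w m)"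
    using assms by (simp add: fractional_partition_def)
  also have "\<dots> \<le> (\<Sum>m\<in>M. w m)"
    using assms by (intro sum_mono2) (auto simp: incident_def fractional_partition_def)
  finally show ?thesis .
qed

lemma uniform_value_nonneg:
  assumes "uniform_feasible A M x p" and "A \<noteq> {}"
  shows "0 \<le> p"
proof -
  obtain a where "a \<in> A"
    using \<open>A \<noteq> {}\<close> by blast
  then have "p = (\<Sum>m\<in>incident M a. x m)"
    using assms by (simp add: uniform_feasible_def)
  also have "\<dots> \<ge> 0"
    using assms by (intro sum_nonneg) (auto simp: incident_def uniform_feasible_def)
  finally show ?thesis .
qed

text \<open>
  The empty edge contains no vertex, so it can absorb the whole unit of weight without
  contributing to any vertex constraint.
\<close>

lemma uniform_feasible_0:
  assumes "finite M" and "{} \<in> M"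
  shows "uniform_feasible A M (\<lambda>m. if m = {} then 1 else 0) 0"
  using assms by (auto simp: uniform_feasible_def incident_def intro!: sum.neutral)

lemma uniform_values_eq:
  assumes "finite M" and "A \<noteq> {}" and "{} \<in> M"
  shows "{p. \<exists>x. uniform_feasible A M x p} =
    insert 0 ((\<lambda>t. 1 / t) ` {(\<Sum>m\<in>M. w m) |w. fractional_partition A M w})" (is "?L = ?R")
proof (intro equalityI subsetI)
  fix p assume "p \<in> ?L"
  then obtain x where x: "uniform_feasible A M x p"
    by blast
  show "p \<in> ?R"
  proof (cases "p = 0")
    case False
    then have "0 < p"
      using uniform_value_nonneg[OF x \<open>A \<noteq> {}\<close>] by simp
    note w = partition_of_uniform[OF x this]
    have "p = 1 / (\<Sum>m\<in>M. x m / p)"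
      unfolding w(2) by simp
    then show ?thesis
      using w(1) by blast
  qed simp
next
  fix p assume "p \<in> ?R"
  then consider "p = 0" | w where "fractional_partition A M w" "p = 1 / (\<Sum>m\<in>M. w m)"
    by blast
  then show "p \<in> ?L"
  proof cases
    case 1
    then show ?thesis
      using uniform_feasible_0[OF \<open>finite M\<close> \<open>{} \<in> M\<close>] by blast
  next
    case 2
    then have "0 < (\<Sum>m\<in>M. w m)"
      using partition_total_ge_1 assms by fastforce
    then show ?thesis
      using uniform_of_partition 2 by blast
  qed
qed

text \<open>
  The lower bound \<open>1\<close> keeps the infimum away from \<open>0\<close>, so its reciprocal is finite. With no
  elements in \<open>T\<close> the infimum is \<open>\<infinity>\<close>, and \<open>0\<close> alone is left under the supremum.
\<close>

lemma Sup_reciprocals: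
  fixes T :: "real set"
  assumes T: "\<And>t. t \<in> T \<Longrightarrow> 1 \<le> t"
  shows "Sup (ereal ` insert 0 ((\<lambda>t. 1 / t) ` T)) =
    (if \<bar>Inf (ereal ` T)\<bar> \<noteq> \<infinity> then 1 / Inf (ereal ` T) else 0)"
proof (cases "T = {}")
  case True
  then show ?thesis
    by (simp add: top_ereal_def)
next
  case False
  then obtain t0 where t0: "t0 \<in> T"
    by blast
  have "1 \<le> Inf (ereal ` T)"
    using T by (auto intro!: Inf_greatest simp: one_ereal_def)
  moreover have "Inf (ereal ` T) \<le> ereal t0"
    using t0 by (simp add: Inf_lower)
  ultimately obtain r where r: "Inf (ereal ` T) = ereal r" "1 \<le> r"
    by (cases "Inf (ereal ` T)") auto
  have "Sup (ereal ` insert 0 ((\<lambda>t. 1 / t) ` T)) = ereal (1 / r)"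
  proof (rule Sup_eqI)
    fix y assume "y \<in> ereal ` insert 0 ((\<lambda>t. 1 / t) ` T)"
    then consider "y = 0" | t where "t \<in> T" "y = ereal (1 / t)"
      by (auto simp: zero_ereal_def)
    then show "y \<le> ereal (1 / r)"
    proof cases
      case 1
      then show ?thesis
        using r by simp
    next
      case 2
      then have "ereal r \<le> ereal t"
        unfolding r(1)[symmetric] by (simp add: Inf_lower)
      then show ?thesis
        using 2 r by (simp add: frac_le)
    qed
  next
    fix y assume y: "\<And>z. z \<in> ereal ` insert 0 ((\<lambda>t. 1 / t) ` T) \<Longrightarrow> z \<le> y"
    then have le: "ereal (1 / t) \<le> y" if "t \<in> T" for t
      using that by blast
    show "ereal (1 / r) \<le> y"
    proof (cases y)
      case (real q)
      have "0 < 1 / t0"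
        using T[OF t0] by simp
      also have "1 / t0 \<le> q"
        using le[OF t0] real by simp
      finally have "0 < q" .
      \<comment> \<open>An upper bound of the reciprocals gives, inverted, a lower bound of \<open>T\<close>.\<close>
      have "ereal (1 / q) \<le> Inf (ereal ` T)"
      proof (rule Inf_greatest, clarify)
        fix t assume t: "t \<in> T"
        then have "1 / t \<le> q"
          using le real by simp
        then show "ereal (1 / q) \<le> ereal t"
          using T[OF t] \<open>0 < q\<close> by (simp add: field_simps)
      qed
      then show ?thesis
        using r real \<open>0 < q\<close> by (simp add: field_simps)
    qed (use le[OF t0] in auto)
  qed
  then show ?thesis
    using r by (simp add: one_ereal_def)
qed

theorem lemma1:
  fixes A :: "'a set" and M :: "'a set set"
  assumes "finite A" and "A \<noteq> {}"
    and "M \<subseteq> Pow A" and "{} \<in> M"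
    and "\<forall>a\<in>A. \<exists>m\<in>M. a \<in> m"
  shows "uniform_fairness A M =
    (if \<bar>fractional_partitioning_number A M\<bar> \<noteq> \<infinity>
     then 1 / fractional_partitioning_number A M else 0)"
proof -
  define T where "T = {(\<Sum>m\<in>M. w m) |w. fractional_partition A M w}"
  have fin: "finite M"
    using \<open>finite A\<close> \<open>M \<subseteq> Pow A\<close> by (meson finite_Pow_iff finite_subset)
  have ge: "1 \<le> t" if "t \<in> T" for t
    using that partition_total_ge_1[OF _ fin \<open>A \<noteq> {}\<close>] unfolding T_def by blast
  have "uniform_fairness A M = Sup (ereal ` {p. \<exists>x. uniform_feasible A M x p})"
    unfolding uniform_fairness_def by (rule arg_cong[where f = Sup]) blast
  also have "\<dots> = Sup (ereal ` insert 0 ((\<lambda>t. 1 / t) ` T))"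
    unfolding T_def uniform_values_eq[OF fin \<open>A \<noteq> {}\<close> \<open>{} \<in> M\<close>] ..
  also have "\<dots> = (if \<bar>Inf (ereal ` T)\<bar> \<noteq> \<infinity> then 1 / Inf (ereal ` T) else 0)"
    by (rule Sup_reciprocals) (rule ge)
  also have "Inf (ereal ` T) = fractional_partitioning_number A M"
    unfolding fractional_partitioning_number_def T_def by (rule arg_cong[where f = Inf]) blast
  finally show ?thesis .
qed

end
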